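(* Let $K$ be the Dynkin diagram of type $ADE$ associated with the root system $\Phi\subset\mathbb{Z}^n$. Given $\tau\in\mathbb{C}^n$, let $$\Phi\cap\tau^\perp=\Phi_1\cup\cdots\cup\Phi_r$$ be the corresponding decomposition into (irreducible) $ADE$ root systems. Then there exists a full subgraph $K'\subset K$ and a decomposition $K'=K_1\sqcup\cdots\sqcup K_r$ into connected components such that $\Phi_i$ is isomorphic to the root system associated with $K_i$ for each $i$.
   Context: $K$ is a connected Dynkin diagram of type $A_n,D_n,E_6,E_7$ or $E_8$ with vertex set $\{1,\dots,n\}$, $C=2\,\mathrm{Id}-A$ its Cartan matrix ($A$ the adjacency matrix), $(v,w)_C=v\cdot Cw$, and $\Phi=\{\alpha\in\mathbb{Z}^n:(\alpha,\alpha)_C=2\}\subset\mathbb{R}^n$ its root system, with the coordinate vectors as simple roots. For $\tau\in\mathbb{C}^n$, $\tau^\perp=\mathrm{Span}_{\mathbb R}(\mathrm{Re}\,\tau,\mathrm{Im}\,\tau)^\perp\subset\mathbb{R}^n$ with respect to the standard scalar product. When nonempty, $\Phi\cap\tau^\perp$ is a root system in the subspace it spans (with inner product $(\cdot,\cdot)_C$), and the $\Phi_i$ are its irreducible components, each of type $A$, $D$ or $E$; if it is empty then $r=0$. A subgraph $K'$ of $K$ is full if every edge of $K$ connecting two vertices of $K'$ belongs to $K'$. Each connected full subgraph of $K$ is again a Dynkin diagram of type $ADE$ and so has an associated root system. *)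

theory Defs
  imports
    "Graph_Theory.Digraph_Isomorphism"
    "Graph_Theory.Pair_Digraph"
    "HOL-Analysis.Analysis"
begin

section \<open>Graphs and Dynkin diagrams\<close>

text \<open>
  Undirected simple graphs are symmetric loop-free digraphs without parallel arcs. The standard
  Dynkin diagrams below are numbered as in Bourbaki; a diagram with vertices of an arbitrary type
  is one isomorphic to a standard one, so its vertices may be labelled in any way.
\<close>

definition undirected :: "'a set \<Rightarrow> 'a rel \<Rightarrow> 'a pair_pre_digraph" where
  "undirected V E = \<lparr>pverts = V, parcs = E \<union> E\<inverse>\<rparr>"

definition diagram_A :: "nat \<Rightarrow> nat pair_pre_digraph" where
  "diagram_A n = undirected {1..n} {(i, i + 1) | i. 1 \<le> i \<and> i < n}"

definition diagram_D :: "nat \<Rightarrow> nat pair_pre_digraph" where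
  "diagram_D n = undirected {1..n} ({(i, i + 1) | i. 1 \<le> i \<and> i < n - 1} \<union> {(n - 2, n)})"

definition diagram_E :: "nat \<Rightarrow> nat pair_pre_digraph" where
  "diagram_E n = undirected {1..n} ({(1, 3), (2, 4)} \<union> {(i, i + 1) | i. 3 \<le> i \<and> i < n})"

definition ADE_diagram :: "('v, 'e) pre_digraph \<Rightarrow> bool" where
  "ADE_diagram K \<longleftrightarrow>
     (\<exists>n\<ge>1. digraph_iso (with_proj (diagram_A n)) K) \<or>
     (\<exists>n\<ge>4. digraph_iso (with_proj (diagram_D n)) K) \<or>
     (\<exists>n\<in>{6, 7, 8}. digraph_iso (with_proj (diagram_E n)) K)"

definition connected_components :: "('v, 'e) pre_digraph \<Rightarrow> ('v, 'e) pre_digraph set" where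
  "connected_components G = {H. pre_digraph.max_subgraph G Digraph_Component.connected H}"

section \<open>The root system of a graph\<close>

text \<open>
  For a graph whose vertex set is a subset of the finite type \<open>'n\<close>, the spaces of integer and real
  vectors indexed by its vertices are embedded into \<open>real ^ 'n\<close> by extension by zero. Accordingly
  the Cartan matrix is zero in the rows and columns of the remaining indices; if all of \<open>'n\<close>
  are vertices, it is twice the identity minus the adjacency matrix.
\<close>

definition cartan_matrix :: "('n::finite, 'e) pre_digraph \<Rightarrow> real ^ 'n ^ 'n" where
  "cartan_matrix G =
     (\<chi> i j. (if i = j \<and> i \<in> verts G then 2 else 0) - (if (i, j) \<in> arcs_ends G then 1 else 0))"

definition cartan_form :: "('n::finite, 'e) pre_digraph \<Rightarrow> real ^ 'n \<Rightarrow> real ^ 'n \<Rightarrow> real" where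
  "cartan_form G v w = v \<bullet> (cartan_matrix G *v w)"

definition roots :: "('n::finite, 'e) pre_digraph \<Rightarrow> (real ^ 'n) set" where
  "roots G =
     {\<alpha>. (\<forall>i. \<alpha> $ i \<in> \<int>) \<and> (\<forall>i. i \<notin> verts G \<longrightarrow> \<alpha> $ i = 0) \<and> cartan_form G \<alpha> \<alpha> = 2}"

definition perp :: "complex ^ 'n \<Rightarrow> (real ^ 'n::finite) set" where
  "perp \<tau> = orthogonal_comp (span {\<chi> i. Re (\<tau> $ i), \<chi> i. Im (\<tau> $ i)})"

section \<open>Abstract root systems\<close>

definition inner_product_on :: "'a::real_vector set \<Rightarrow> ('a \<Rightarrow> 'a \<Rightarrow> real) \<Rightarrow> bool" where
  "inner_product_on S B \<longleftrightarrow>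
     bilinear B \<and> (\<forall>x y. B x y = B y x) \<and> (\<forall>x\<in>S. x \<noteq> 0 \<longrightarrow> B x x > 0)"

definition cartan_integer :: "('a \<Rightarrow> 'a \<Rightarrow> real) \<Rightarrow> 'a \<Rightarrow> 'a \<Rightarrow> real" where
  "cartan_integer B \<beta> \<alpha> = 2 * B \<beta> \<alpha> / B \<alpha> \<alpha>"

text \<open>\<open>R\<close> is a (reduced, crystallographic) root system in the Euclidean space \<open>(span R, B)\<close>.\<close>

definition root_system :: "('a::real_vector \<Rightarrow> 'a \<Rightarrow> real) \<Rightarrow> 'a set \<Rightarrow> bool" where
  "root_system B R \<longleftrightarrow>
     inner_product_on (span R) B \<and> finite R \<and> 0 \<notin> R \<and>
     (\<forall>\<alpha>\<in>R. \<forall>c. c *\<^sub>R \<alpha> \<in> R \<longleftrightarrow> c = 1 \<or> c = - 1) \<and>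
     (\<forall>\<alpha>\<in>R. \<forall>\<beta>\<in>R. \<beta> - cartan_integer B \<beta> \<alpha> *\<^sub>R \<alpha> \<in> R) \<and>
     (\<forall>\<alpha>\<in>R. \<forall>\<beta>\<in>R. cartan_integer B \<beta> \<alpha> \<in> \<int>)"

definition irreducible_root_system :: "('a::real_vector \<Rightarrow> 'a \<Rightarrow> real) \<Rightarrow> 'a set \<Rightarrow> bool" where
  "irreducible_root_system B R \<longleftrightarrow>
     root_system B R \<and> R \<noteq> {} \<and>
     \<not> (\<exists>S T. S \<noteq> {} \<and> T \<noteq> {} \<and> S \<inter> T = {} \<and> R = S \<union> T \<and> (\<forall>\<alpha>\<in>S. \<forall>\<beta>\<in>T. B \<alpha> \<beta> = 0))"

text \<open>The family \<open>\<Phi>\<close> enumerates the irreducible components of \<open>R\<close> without repetition.\<close>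

definition irreducible_decomposition ::
  "('a::real_vector \<Rightarrow> 'a \<Rightarrow> real) \<Rightarrow> 'a set \<Rightarrow> 'i set \<Rightarrow> ('i \<Rightarrow> 'a set) \<Rightarrow> bool" where
  "irreducible_decomposition B R I \<Phi> \<longleftrightarrow>
     R = (\<Union>i\<in>I. \<Phi> i) \<and> (\<forall>i\<in>I. irreducible_root_system B (\<Phi> i)) \<and>
     (\<forall>i\<in>I. \<forall>j\<in>I. i \<noteq> j \<longrightarrow> \<Phi> i \<inter> \<Phi> j = {} \<and> (\<forall>\<alpha>\<in>\<Phi> i. \<forall>\<beta>\<in>\<Phi> j. B \<alpha> \<beta> = 0))"

text \<open>
  An isomorphism is a linear isomorphism of the spanned spaces that maps roots onto roots and
  preserves the Cartan integers. It is taken to be defined on the whole ambient space, which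
  is no restriction since linear maps extend from subspaces.
\<close>

definition root_system_isomorphic ::
  "('a::real_vector \<Rightarrow> 'a \<Rightarrow> real) \<Rightarrow> 'a set \<Rightarrow> ('b::real_vector \<Rightarrow> 'b \<Rightarrow> real) \<Rightarrow> 'b set \<Rightarrow> bool" where
  "root_system_isomorphic B R B' R' \<longleftrightarrow>
     (\<exists>f. linear f \<and> bij_betw f (span R) (span R') \<and> f ` R = R' \<and>
        (\<forall>\<alpha>\<in>R. \<forall>\<beta>\<in>R. cartan_integer B' (f \<beta>) (f \<alpha>) = cartan_integer B \<beta> \<alpha>))"

end

theory Submission
  imports Defs
begin

text \<open>
  The roots are finitely many, so a single functional \<open>c\<close> vanishes on the same roots as both
  \<open>Re \<tau>\<close> and \<open>Im \<tau>\<close>. Moving \<open>c\<close> by an automorphism of the root system makes it nonnegative on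
  all simple roots. As the coordinates of a root all have the same sign, \<open>c\<close> then vanishes exactly
  on the roots supported on the set \<open>J\<close> of the simple roots that it kills, and these are the
  roots of the full subgraph on \<open>J\<close>. Each vertex of \<open>J\<close> belongs, as a simple root, to one
  irreducible component, and the vertices belonging to the same one form a connected component
  of that subgraph.
\<close>

section \<open>Positive definiteness of the Dynkin diagrams\<close>

text \<open>For a symmetric graph this is positive definiteness of the Cartan quadratic form. The
  weights are functions on the vertex type because the standard diagrams have vertices in the
  infinite type \<open>nat\<close>, while \<open>cartan_form\<close> needs a finite index
  type.\<close>

definition positive_graph :: "('a, 'e) pre_digraph \<Rightarrow> bool" where
  "positive_graph G \<longleftrightarrow>
     (\<forall>x :: 'a \<Rightarrow> real. (\<exists>v\<in>verts G. x v \<noteq> 0) \<longrightarrow>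
        (\<Sum>(u, v)\<in>arcs_ends G. x u * x v) < 2 * (\<Sum>v\<in>verts G. (x v)\<^sup>2))"

section \<open>The quadratic form of a path\<close>

lemma chain_form_Suc:
  fixes x :: "nat \<Rightarrow> real"
  assumes "m \<ge> 1"
  shows "(\<Sum>i=1..Suc m. (x i)\<^sup>2) - (\<Sum>i=1..<Suc m. x i * x (i + 1)) =
    (\<Sum>i=1..m. (x i)\<^sup>2) - (\<Sum>i=1..<m. x i * x (i + 1)) + (x (m + 1))\<^sup>2 - x m * x (m + 1)"
proof -
  have "(\<Sum>i=1..<Suc m. x i * x (i + 1)) = (\<Sum>i=1..<m. x i * x (i + 1)) + x m * x (m + 1)"
    using assms by (subst sum.atLeastLessThan_Suc) auto
  then show ?thesis by simp
qed

text \<open>The minimum over the other entries is attained at \<open>x i = i / m * x m\<close>.\<close>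

lemma chain_form_ge:
  fixes x :: "nat \<Rightarrow> real"
  assumes "m \<ge> 1"
  shows "(\<Sum>i=1..m. (x i)\<^sup>2) - (\<Sum>i=1..<m. x i * x (i + 1)) \<ge> (real m + 1) / (2 * real m) * (x m)\<^sup>2"
  using assms
proof (induction m rule: nat_induct_at_least)
  case base
  then show ?case by simp
next
  case (Suc m)
  \<comment> \<open>The gap between the two successive bounds is a perfect square with positive
    factor, zero exactly at the minimiser \<open>a = t / (t + 1) * b\<close>.\<close>
  have "(t + 1) / (2 * t) * a\<^sup>2 + b\<^sup>2 - a * b - (t + 2) / (2 * (t + 1)) * b\<^sup>2
      = ((t + 1) * a - t * b)\<^sup>2 / (2 * t * (t + 1))" if "t > 0" for t a b :: real
    using that by (simp add: divide_simps) (simp add: algebra_simps power2_eq_square)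
  from this[of "real m" "x m" "x (m + 1)"]
  have "(real m + 2) / (2 * (real m + 1)) * (x (m + 1))\<^sup>2
      \<le> (real m + 1) / (2 * real m) * (x m)\<^sup>2 + (x (m + 1))\<^sup>2 - x m * x (m + 1)"
    using Suc.hyps by (smt (verit) divide_nonneg_nonneg mult_nonneg_nonneg of_nat_0_less_iff
        less_eq_Suc_le One_nat_def zero_le_power2)
  with Suc.IH have "(real m + 2) / (2 * (real m + 1)) * (x (m + 1))\<^sup>2
      \<le> (\<Sum>i=1..Suc m. (x i)\<^sup>2) - (\<Sum>i=1..<Suc m. x i * x (i + 1))"
    unfolding chain_form_Suc[OF Suc.hyps] by linarith
  then show ?case by (simp add: add.commute)
qed

text \<open>The lower bound has a positive factor before the last square, so the last entry
  vanishes; removing it leaves the same situation on a shorter path.\<close>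

lemma chain_form_eq_0:
  fixes x :: "nat \<Rightarrow> real"
  assumes "m \<ge> 1" and "(\<Sum>i=1..m. (x i)\<^sup>2) - (\<Sum>i=1..<m. x i * x (i + 1)) \<le> 0"
  shows "\<forall>i\<in>{1..m}. x i = 0"
  using assms
proof (induction m rule: nat_induct_at_least)
  case base
  then show ?case by simp
next
  case (Suc m)
  have "(real (Suc m) + 1) / (2 * real (Suc m)) * (x (Suc m))\<^sup>2 \<le> 0"
    by (rule order_trans[OF chain_form_ge Suc.prems]) simp
  moreover have "0 < (real (Suc m) + 1) / (2 * real (Suc m))"
    by (simp del: of_nat_Suc)
  ultimately have 0: "x (Suc m) = 0"
    by (metis mult_le_0_iff not_less power2_less_eq_zero_iff)
  with Suc.prems have "(\<Sum>i=1..m. (x i)\<^sup>2) - (\<Sum>i=1..<m. x i * x (i + 1)) \<le> 0"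
    unfolding chain_form_Suc[OF Suc.hyps] by simp
  from Suc.IH[OF this] 0 show ?case
    by (auto simp: le_Suc_eq)
qed

section \<open>The standard diagrams\<close>

text \<open>As \<open>E\<close> is disjoint from its converse, the sum over arcs is exactly twice
  the sum over \<open>E\<close>. It is therefore enough to treat half the form, in which each edge
  occurs once.\<close>

lemma positive_graph_undirected:
  fixes V :: "'a set"
  assumes "finite E" and "E \<inter> E\<inverse> = {}"
    and "\<And>x :: 'a \<Rightarrow> real. (\<Sum>v\<in>V. (x v)\<^sup>2) - (\<Sum>(u, v)\<in>E. x u * x v) \<le> 0 \<Longrightarrow> \<forall>v\<in>V. x v = 0"
  shows "positive_graph (with_proj (undirected V E))"
proof -
  have "(\<Sum>(u, v)\<in>E \<union> E\<inverse>. x u * x v) < 2 * (\<Sum>v\<in>V. (x v)\<^sup>2)"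
    if "\<exists>v\<in>V. x v \<noteq> 0" for x :: "'a \<Rightarrow> real"
  proof -
    have "(\<Sum>(u, v)\<in>E\<inverse>. x u * x v) = (\<Sum>(u, v)\<in>E. x u * x v)"
      by (rule sum.reindex_bij_witness[of _ prod.swap prod.swap]) auto
    then have "(\<Sum>(u, v)\<in>E \<union> E\<inverse>. x u * x v) = 2 * (\<Sum>(u, v)\<in>E. x u * x v)"
      using assms(1,2) by (simp add: sum.union_disjoint)
    moreover have "\<not> (\<Sum>v\<in>V. (x v)\<^sup>2) - (\<Sum>(u, v)\<in>E. x u * x v) \<le> 0"
      using assms(3)[of x] that by blast
    ultimately show ?thesis by linarith
  qed
  then show ?thesis
    by (simp add: positive_graph_def undirected_def)
qed

lemma successor_pairs_eq: "{(i, i + 1) | i. a \<le> i \<and> i < b} = (\<lambda>i. (i, i + 1)) ` {a..<b :: nat}"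
  by auto

lemma sum_successor_pairs:
  fixes x :: "nat \<Rightarrow> real"
  shows "(\<Sum>(u, v)\<in>(\<lambda>i. (i, i + 1)) ` {a..<b}. x u * x v) = (\<Sum>i=a..<b. x i * x (i + 1))"
  by (simp add: sum.reindex inj_on_def)

lemma positive_diagram_A: "positive_graph (with_proj (diagram_A n))"
  unfolding diagram_A_def successor_pairs_eq
proof (rule positive_graph_undirected)
  fix x :: "nat \<Rightarrow> real"
  assume "(\<Sum>v = 1..n. (x v)\<^sup>2)
    - (\<Sum>(u, v)\<in>(\<lambda>i. (i, i + 1)) ` {1..<n}. x u * x v) \<le> 0"
  then have "(\<Sum>i=1..n. (x i)\<^sup>2) - (\<Sum>i=1..<n. x i * x (i + 1)) \<le> 0"
    unfolding sum_successor_pairs .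
  then show "\<forall>v\<in>{1..n}. x v = 0"
    using chain_form_eq_0[of n x] by (meson atLeastAtMost_iff order_trans)
qed auto

text \<open>The branch vertex is \<open>m = n - 2\<close>: it ends the path on \<open>{1..m}\<close>
  and carries two leaves. Completing squares in the leaves costs half the square of
  \<open>x m\<close>, whereas the path supplies that half plus a further \<open>1 / (2 * m)\<close>
  of the square. This excess forces \<open>x m = 0\<close>, after which the leaves and the path
  vanish separately.\<close>

lemma positive_diagram_D:
  assumes "n \<ge> 4"
  shows "positive_graph (with_proj (diagram_D n))"
  unfolding diagram_D_def successor_pairs_eq
proof (rule positive_graph_undirected)
  fix x :: "nat \<Rightarrow> real"
  define m where "m = n - 2"
  have m: "m \<ge> 1" "n = m + 2" using assms by (auto simp: m_def)
  define q where "q = (\<Sum>i=1..m. (x i)\<^sup>2) - (\<Sum>i=1..<m. x i * x (i + 1))"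
  assume "(\<Sum>v = 1..n. (x v)\<^sup>2)
    - (\<Sum>(u, v)\<in>(\<lambda>i. (i, i + 1)) ` {1..<n - 1} \<union> {(n - 2, n)}. x u * x v) \<le> 0"
  moreover have "(\<Sum>v = 1..n. (x v)\<^sup>2) = (\<Sum>i=1..m. (x i)\<^sup>2) + (x (m + 1))\<^sup>2 + (x (m + 2))\<^sup>2"
    by (simp add: m)
  moreover have "(\<Sum>(u, v)\<in>(\<lambda>i. (i, i + 1)) ` {1..<n - 1} \<union> {(n - 2, n)}. x u * x v)
      = (\<Sum>i=1..<Suc m. x i * x (i + 1)) + x m * x (m + 2)"
    by (subst sum.union_disjoint) (auto simp: m sum.reindex inj_on_def)
  moreover have "(\<Sum>i=1..<Suc m. x i * x (i + 1)) = (\<Sum>i=1..<m. x i * x (i + 1)) + x m * x (m + 1)"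
    using m by (subst sum.atLeastLessThan_Suc) auto
  ultimately have q: "q + (x (m + 1))\<^sup>2 + (x (m + 2))\<^sup>2 - x m * x (m + 1) - x m * x (m + 2) \<le> 0"
    by (simp add: q_def)
  have "(x (m + 1))\<^sup>2 + (x (m + 2))\<^sup>2 - x m * x (m + 1) - x m * x (m + 2) =
      (x (m + 1) - x m / 2)\<^sup>2 + (x (m + 2) - x m / 2)\<^sup>2 - (x m)\<^sup>2 / 2"
    by (simp add: field_simps power2_eq_square)
  with q have q': "q + (x (m + 1) - x m / 2)\<^sup>2 + (x (m + 2) - x m / 2)\<^sup>2 - (x m)\<^sup>2 / 2 \<le> 0"
    by simp
  have "(real m + 1) / (2 * real m) * (x m)\<^sup>2 = (x m)\<^sup>2 / 2 + (x m)\<^sup>2 / (2 * m)"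
    using m by (simp add: field_simps)
  then have q'': "q \<ge> (x m)\<^sup>2 / 2 + (x m)\<^sup>2 / (2 * m)"
    unfolding q_def using chain_form_ge[OF m(1), of x] by linarith
  have nn: "0 \<le> (x (m + 1) - x m / 2)\<^sup>2" "0 \<le> (x (m + 2) - x m / 2)\<^sup>2" by simp_all
  have "(x m)\<^sup>2 / (2 * m) \<le> 0" using q' q'' nn by linarith
  then have xm: "x m = 0"
    using m by (simp add: divide_le_0_iff)
  have "q \<ge> 0" using q'' xm by simp
  moreover have "q + (x (m + 1))\<^sup>2 + (x (m + 2))\<^sup>2 \<le> 0" using q xm by simp
  ultimately have "(x (m + 1))\<^sup>2 \<le> 0" "(x (m + 2))\<^sup>2 \<le> 0" "q \<le> 0"
    using zero_le_power2[of "x (m + 1)"] zero_le_power2[of "x (m + 2)"] by linarith+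
  then have "x (m + 1) = 0" "x (m + 2) = 0" and "q \<le> 0"
    by simp_all
  moreover from \<open>q \<le> 0\<close> have "\<forall>i\<in>{1..m}. x i = 0"
    unfolding q_def by (rule chain_form_eq_0[OF m(1)])
  moreover have "{1..n} = {1..m} \<union> {m + 1, m + 2}"
    by (auto simp: m(2))
  ultimately show "\<forall>v\<in>{1..n}. x v = 0"
    by simp
qed (use assms in auto)

text \<open>The coefficient \<open>1 / 60\<close> of \<open>x4\<^sup>2\<close> is \<open>1 - 1 / 4 - 1 / 3 - 2 / 5\<close>, what the three arms of the
  star leave over after completing squares towards its centre.\<close>

lemma E8_form_eq_0:
  fixes x1 x2 x3 x4 x5 x6 x7 x8 :: real
  assumes "x1\<^sup>2 + x2\<^sup>2 + x3\<^sup>2 + x4\<^sup>2 + x5\<^sup>2 + x6\<^sup>2 + x7\<^sup>2 + x8\<^sup>2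
    - (x1 * x3 + x2 * x4 + x3 * x4 + x4 * x5 + x5 * x6 + x6 * x7 + x7 * x8) \<le> 0"
  shows "x1 = 0 \<and> x2 = 0 \<and> x3 = 0 \<and> x4 = 0 \<and> x5 = 0 \<and> x6 = 0 \<and> x7 = 0 \<and> x8 = 0"
proof -
  have "x1\<^sup>2 + x2\<^sup>2 + x3\<^sup>2 + x4\<^sup>2 + x5\<^sup>2 + x6\<^sup>2 + x7\<^sup>2 + x8\<^sup>2
    - (x1 * x3 + x2 * x4 + x3 * x4 + x4 * x5 + x5 * x6 + x6 * x7 + x7 * x8) =
    (x2 - x4 / 2)\<^sup>2 + (x1 - x3 / 2)\<^sup>2 + 3 / 4 * (x3 - 2 / 3 * x4)\<^sup>2 +
    (x8 - x7 / 2)\<^sup>2 + 3 / 4 * (x7 - 2 / 3 * x6)\<^sup>2 + 2 / 3 * (x6 - 3 / 4 * x5)\<^sup>2 +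
    5 / 8 * (x5 - 4 / 5 * x4)\<^sup>2 + 1 / 60 * x4\<^sup>2"
    by (simp add: field_simps power2_eq_square)
  with assms have *: "(x2 - x4 / 2)\<^sup>2 + (x1 - x3 / 2)\<^sup>2 + 3 / 4 * (x3 - 2 / 3 * x4)\<^sup>2 +
    (x8 - x7 / 2)\<^sup>2 + 3 / 4 * (x7 - 2 / 3 * x6)\<^sup>2 + 2 / 3 * (x6 - 3 / 4 * x5)\<^sup>2 +
    5 / 8 * (x5 - 4 / 5 * x4)\<^sup>2 + 1 / 60 * x4\<^sup>2 \<le> 0"
    by linarith
  have nn: "0 \<le> (x2 - x4 / 2)\<^sup>2" "0 \<le> (x1 - x3 / 2)\<^sup>2" "0 \<le> (x3 - 2 / 3 * x4)\<^sup>2"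
    "0 \<le> (x8 - x7 / 2)\<^sup>2" "0 \<le> (x7 - 2 / 3 * x6)\<^sup>2" "0 \<le> (x6 - 3 / 4 * x5)\<^sup>2"
    "0 \<le> (x5 - 4 / 5 * x4)\<^sup>2" "0 \<le> x4\<^sup>2"
    by simp_all
  have "(x2 - x4 / 2)\<^sup>2 \<le> 0" "(x1 - x3 / 2)\<^sup>2 \<le> 0" "(x3 - 2 / 3 * x4)\<^sup>2 \<le> 0"
    "(x8 - x7 / 2)\<^sup>2 \<le> 0" "(x7 - 2 / 3 * x6)\<^sup>2 \<le> 0" "(x6 - 3 / 4 * x5)\<^sup>2 \<le> 0"
    "(x5 - 4 / 5 * x4)\<^sup>2 \<le> 0" "x4\<^sup>2 \<le> 0"
    using * nn by linarith+
  then show ?thesis by simp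
qed

lemma positive_diagram_E:
  assumes "n \<in> {6, 7, 8}"
  shows "positive_graph (with_proj (diagram_E n))"
  unfolding diagram_E_def successor_pairs_eq
proof (rule positive_graph_undirected)
  fix x :: "nat \<Rightarrow> real"
  assume "(\<Sum>v = 1..n. (x v)\<^sup>2)
    - (\<Sum>(u, v)\<in>{(1, 3), (2, 4)} \<union> (\<lambda>i. (i, i + 1)) ` {3..<n}. x u * x v) \<le> 0"
  moreover have "(\<Sum>(u, v)\<in>{(1, 3), (2, 4)} \<union> (\<lambda>i. (i, i + 1)) ` {3..<n}. x u * x v)
      = x 1 * x 3 + x 2 * x 4 + (\<Sum>i=3..<n. x i * x (i + 1))"
    by (subst sum.union_disjoint) (auto simp: sum.reindex inj_on_def)
  moreover have "{1..6} = {1, 2, 3, 4, 5, 6 :: nat}" "{1..7} = {1, 2, 3, 4, 5, 6, 7 :: nat}"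
    "{1..8} = {1, 2, 3, 4, 5, 6, 7, 8 :: nat}" "{3..<6} = {3, 4, 5 :: nat}"
    "{3..<7} = {3, 4, 5, 6 :: nat}" "{3..<8} = {3, 4, 5, 6, 7 :: nat}"
    by auto
  \<comment> \<open>Putting 0 for the missing last entries turns the forms of E6 and E7 into that of
    E8.\<close>
  ultimately show "\<forall>v\<in>{1..n}. x v = 0"
    using assms E8_form_eq_0[of "x 1" "x 2" "x 3" "x 4" "x 5" "x 6"
        "if n \<ge> 7 then x 7 else 0" "if n \<ge> 8 then x 8 else 0"]
    by auto
qed auto

section \<open>Transfer along isomorphisms\<close>

text \<open>The Cartan form sees only the vertices and the adjacency relation, so of an isomorphism
  only the vertex map is kept.\<close>

lemma digraph_iso_cases:
  assumes "digraph_iso G H"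
  obtains h where "wf_digraph G" "wf_digraph H" "inj_on h (verts G)" "verts H = h ` verts G"
    "arcs_ends H = map_prod h h ` arcs_ends G"
proof -
  from assms obtain f where f: "pre_digraph.digraph_isomorphism G f" "H = app_iso f G"
    unfolding digraph_iso_def by blast
  then have wf: "wf_digraph G" by (simp add: pre_digraph.digraph_isomorphism_def)
  then interpret wf_digraph G .
  show ?thesis
  proof
    show "wf_digraph H" using f wf_digraphI_app_iso by simp
    show "inj_on (iso_verts f) (verts G)" using f by (simp add: digraph_isomorphism_def)
    show "verts H = iso_verts f ` verts G" by (simp add: f verts_app_iso)
    show "arcs_ends H = map_prod (iso_verts f) (iso_verts f) ` arcs_ends G"
      using arcs_ends_app_iso_eq[OF f(1)] f(2) by (simp add: map_prod_def)
  qed (rule wf)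
qed

lemma (in wf_digraph) arcs_ends_subset: "arcs_ends G \<subseteq> verts G \<times> verts G"
  by (auto simp: arcs_ends_conv)

lemma positive_graph_iso:
  assumes "digraph_iso G H" and "positive_graph G"
  shows "positive_graph H"
proof -
  from assms(1) obtain h where h: "wf_digraph G" "inj_on h (verts G)" "verts H = h ` verts G"
    "arcs_ends H = map_prod h h ` arcs_ends G"
    by (rule digraph_iso_cases)
  have "inj_on (map_prod h h) (arcs_ends G)"
    by (rule inj_on_subset[OF map_prod_inj_on[OF h(2) h(2)] wf_digraph.arcs_ends_subset[OF h(1)]])
  then have "(\<Sum>(u, v)\<in>arcs_ends H. x u * x v) = (\<Sum>(u, v)\<in>arcs_ends G. x (h u) * x (h v))"
    for x :: "_ \<Rightarrow> real"
    by (simp add: h sum.reindex case_prod_unfold)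
  moreover have "(\<Sum>v\<in>verts H. (x v)\<^sup>2) = (\<Sum>v\<in>verts G. (x (h v))\<^sup>2)" for x :: "_ \<Rightarrow> real"
    by (simp add: h sum.reindex)
  ultimately show ?thesis
    using assms(2) unfolding positive_graph_def by (auto simp: h(3))
qed

lemma ADE_diagram_properties:
  assumes "ADE_diagram K"
  shows "wf_digraph K" and "sym (arcs_ends K)" and "irrefl (arcs_ends K)" and "positive_graph K"
proof -
  from assms obtain G :: "nat pair_pre_digraph"
    where G: "digraph_iso (with_proj G) K" "sym (parcs G)" "irrefl (parcs G)"
      "positive_graph (with_proj G)"
  proof -
    have sym: "sym (parcs (diagram_A n))" "sym (parcs (diagram_D n))" "sym (parcs (diagram_E n))" for n
      by (auto simp: diagram_A_def diagram_D_def diagram_E_def undirected_def sym_def)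
    \<comment> \<open>The bound on \<open>n\<close> excludes \<open>n = 0\<close>, where truncated
      subtraction turns \<open>(n - 2, n)\<close> into a loop.\<close>
    have irrefl: "irrefl (parcs (diagram_A n))" "n \<ge> 4 \<Longrightarrow> irrefl (parcs (diagram_D n))"
      "irrefl (parcs (diagram_E n))" for n
      by (auto simp: diagram_A_def diagram_D_def diagram_E_def undirected_def irrefl_def)
    consider (A) n where "digraph_iso (with_proj (diagram_A n)) K"
      | (D) n where "n \<ge> 4" "digraph_iso (with_proj (diagram_D n)) K"
      | (E) n where "n \<in> {6, 7, 8}" "digraph_iso (with_proj (diagram_E n)) K"
      using assms unfolding ADE_diagram_def by blast
    then show ?thesis
    proof cases
      case (A n)
      then show ?thesis using sym(1) irrefl(1) positive_diagram_A by (rule that)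
    next
      case (D n)
      show ?thesis using D(2) sym(2) irrefl(2)[OF D(1)] positive_diagram_D[OF D(1)] by (rule that)
    next
      case (E n)
      show ?thesis using E(2) sym(3) irrefl(3) positive_diagram_E[OF E(1)] by (rule that)
    qed
  qed
  from G(1) obtain h where h: "wf_digraph (with_proj G)" "wf_digraph K" "inj_on h (pverts G)"
    "arcs_ends K = map_prod h h ` parcs G"
    by (auto elim: digraph_iso_cases)
  have sub: "parcs G \<subseteq> pverts G \<times> pverts G"
    using wf_digraph.arcs_ends_subset[OF h(1)] by simp
  show "wf_digraph K" by fact
  show "sym (arcs_ends K)"
    using G(2) by (force simp: h(4) sym_def)
  show "irrefl (arcs_ends K)"
    using G(3) sub h(3) by (auto simp: h(4) irrefl_def dest!: inj_onD)
  show "positive_graph K"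
    using G(1,4) by (rule positive_graph_iso)
qed

section \<open>Connected components\<close>

lemma arcs_ends_induce_subgraph: "arcs_ends (G \<restriction> J) = arcs_ends G \<inter> J \<times> J"
  by (auto simp: arcs_ends_conv)

lemma induce_subgraph_induce_subgraph: "L \<subseteq> J \<Longrightarrow> (G \<restriction> J) \<restriction> L = G \<restriction> L"
  by (auto simp: induce_subgraph_def)

text \<open>No arc leaves the set of vertices reachable from \<open>u\<close>, so that set cannot be
  proper. Cuts are the convenient form here because a cut without crossing arcs will split a root
  system into orthogonal parts.\<close>

lemma connectedI_cut:
  assumes "verts H \<noteq> {}"
    and cut: "\<And>X. X \<subseteq> verts H \<Longrightarrow> X \<noteq> {} \<Longrightarrow> X \<noteq> verts H \<Longrightarrow>
      \<exists>u\<in>X. \<exists>v\<in>verts H - X. (u, v) \<in> arcs_ends H"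
  shows "connected H"
  unfolding connected_conv
proof (intro conjI ballI)
  fix u v
  assume u: "u \<in> verts H" and v: "v \<in> verts H"
  let ?R = "rtrancl_on (verts H) ((arcs_ends H)\<^sup>s)"
  define X where "X = {y \<in> verts H. (u, y) \<in> ?R}"
  have "X = verts H"
  proof (rule ccontr)
    assume "X \<noteq> verts H"
    moreover have "u \<in> X" "X \<subseteq> verts H" using u by (auto simp: X_def)
    ultimately obtain y z where yz: "y \<in> X" "z \<in> verts H - X" "(y, z) \<in> arcs_ends H"
      using cut[of X] by blast
    then have "(u, z) \<in> ?R"
      by (auto simp: X_def symcl_def intro: rtrancl_on_into_rtrancl_on)
    with yz show False by (auto simp: X_def)
  qed
  with v show "(u, v) \<in> ?R" by (auto simp: X_def)
qed (rule assms(1))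

lemma connected_verts_subset:
  assumes "connected H" and "v \<in> verts H" and "v \<in> L"
    and closed: "\<And>x y. (x, y) \<in> arcs_ends H \<Longrightarrow> x \<in> L \<longleftrightarrow> y \<in> L"
  shows "verts H \<subseteq> L"
proof
  fix u
  assume "u \<in> verts H"
  with assms have "(v, u) \<in> rtrancl_on (verts H) ((arcs_ends H)\<^sup>s)"
    by (simp add: connected_conv)
  then show "u \<in> L"
    using \<open>v \<in> L\<close> by induction (auto simp: symcl_def closed)
qed

text \<open>No arc joins a block to its complement, so a connected subgraph that meets a block stays
  inside it. Hence the connected blocks are maximal, and every component is one of them. Injectivity
  holds since the blocks are nonempty and disjoint.\<close>

lemma (in wf_digraph) connected_components_partition:
  assumes cover: "(\<Union>i\<in>I. L i) = verts G"
    and disjoint: "\<And>i j. i \<in> I \<Longrightarrow> j \<in> I \<Longrightarrow> i \<noteq> j \<Longrightarrow> L i \<inter> L j = {}"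
    and connected: "\<And>i. i \<in> I \<Longrightarrow> connected (G \<restriction> L i)"
    and closed: "\<And>i x y. i \<in> I \<Longrightarrow> (x, y) \<in> arcs_ends G \<Longrightarrow> x \<in> L i \<longleftrightarrow> y \<in> L i"
  shows "bij_betw (\<lambda>i. G \<restriction> L i) I (connected_components G)"
proof -
  have nonempty: "L i \<noteq> {}" if "i \<in> I" for i
    using connected[OF that] by (simp add: connected_conv)
  have subL: "subgraph (G \<restriction> L i) G" if "i \<in> I" for i
    using cover that by (intro subgraph_induce_subgraphI) auto
  have max: "H = G \<restriction> L i"
    if "i \<in> I" "subgraph H G" "connected H" "subgraph (G \<restriction> L i) H" for i H
  proof -
    obtain v where v: "v \<in> L i" using nonempty[OF \<open>i \<in> I\<close>] by blast
    then have "v \<in> verts H" using that(4) by (auto simp: subgraph_def)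
    then have "verts H \<subseteq> L i"
      using that(3) v closed[OF that(1)] arcs_ends_mono[OF that(2)]
      by (intro connected_verts_subset[of H v]) auto
    \<comment> \<open>With all its vertices in \<open>L i\<close>, the subgraph \<open>H\<close> has
      no room for arcs beyond those of the induced subgraph.\<close>
    then show ?thesis
      using that(2,4) by (auto simp: subgraph_def compatible_def wf_digraph_def
          intro!: pre_digraph.equality)
  qed
  have "G \<restriction> L i \<in> connected_components G" if "i \<in> I" for i
    using that subL connected max
    by (auto simp: connected_components_def intro!: max_subgraphI)
  moreover have "H \<in> (\<lambda>i. G \<restriction> L i) ` I" if "H \<in> connected_components G" for H
  proof -
    from that have H: "subgraph H G" "connected H"
      and Hmax: "\<And>H'. H' \<noteq> H \<Longrightarrow> subgraph H H' \<Longrightarrow> subgraph H' G \<Longrightarrow> \<not> connected H'"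
      by (auto simp: connected_components_def max_subgraph_def)
    then obtain v where v: "v \<in> verts H" by (auto simp: connected_conv)
    with H(1) cover have "v \<in> (\<Union>i\<in>I. L i)" by (auto simp: subgraph_def)
    then obtain i where i: "i \<in> I" "v \<in> L i" by blast
    have "verts H \<subseteq> L i"
      using H(2) v i(2) closed[OF i(1)] arcs_ends_mono[OF H(1)]
      by (intro connected_verts_subset[of H v]) auto
    then have "subgraph H (G \<restriction> L i)"
      using H(1) by (auto simp: subgraph_def compatible_def wf_digraph_def)
    with Hmax[of "G \<restriction> L i"] subL[OF i(1)] connected[OF i(1)] have "G \<restriction> L i = H" by blast
    with i show ?thesis by auto
  qed
  moreover have "inj_on (\<lambda>i. G \<restriction> L i) I"
  proof (rule inj_onI)
    fix i j
    assume "i \<in> I" "j \<in> I" "G \<restriction> L i = G \<restriction> L j"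
    then show "i = j"
      using disjoint nonempty by (metis Int_absorb induce_subgraph_verts)
  qed
  ultimately show ?thesis by (auto simp: bij_betw_def)
qed

section \<open>Parabolic root subsystems\<close>

lemma cartan_form_eq:
  "cartan_form G v w = 2 * (\<Sum>i\<in>verts G. v $ i * w $ i) - (\<Sum>(i, j)\<in>arcs_ends G. v $ i * w $ j)"
proof -
  have "cartan_form G v w = (\<Sum>i\<in>UNIV. \<Sum>j\<in>UNIV.
      (if j = i then (if i \<in> verts G then 2 * (v $ i * w $ i) else 0) else 0)
      - (if (i, j) \<in> arcs_ends G then v $ i * w $ j else 0))"
    unfolding cartan_form_def cartan_matrix_def inner_vec_def matrix_vector_mult_def
    by (auto simp: sum_distrib_left algebra_simps intro!: sum.cong)
  also have "\<dots> = (\<Sum>i\<in>UNIV. if i \<in> verts G then 2 * (v $ i * w $ i) else 0) -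
      (\<Sum>i\<in>UNIV. \<Sum>j\<in>UNIV. if (i, j) \<in> arcs_ends G then v $ i * w $ j else 0)"
    by (simp add: sum_subtractf)
  also have "(\<Sum>i\<in>UNIV. if i \<in> verts G then 2 * (v $ i * w $ i) else 0) =
      2 * (\<Sum>i\<in>verts G. v $ i * w $ i)"
    by (simp add: sum.If_cases sum_distrib_left)
  also have "(\<Sum>i\<in>UNIV. \<Sum>j\<in>UNIV. if (i, j) \<in> arcs_ends G then v $ i * w $ j else 0) =
      (\<Sum>(i, j)\<in>UNIV. if (i, j) \<in> arcs_ends G then v $ i * w $ j else 0)"
    by (simp add: sum.cartesian_product)
  also have "\<dots> = (\<Sum>p\<in>UNIV. if p \<in> arcs_ends G then v $ fst p * w $ snd p else 0)"
    by (intro sum.cong) auto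
  also have "\<dots> = (\<Sum>(i, j)\<in>arcs_ends G. v $ i * w $ j)"
    by (simp add: sum.If_cases case_prod_unfold)
  finally show ?thesis .
qed

lemma bilinear_cartan_form: "bilinear (cartan_form G)"
  unfolding bilinear_def cartan_form_def
  by (auto intro!: linearI simp: inner_add_left inner_add_right matrix_vector_right_distrib
      matrix_vector_mult_scaleR)

text \<open>Here fullness matters: every arc with both ends in \<open>J\<close> is kept, and the
  arcs that are lost contribute only zero terms.\<close>

lemma cartan_form_induce_subgraph:
  assumes "J \<subseteq> verts G" and "\<forall>i. i \<notin> J \<longrightarrow> v $ i = 0" and "\<forall>i. i \<notin> J \<longrightarrow> w $ i = 0"
  shows "cartan_form (G \<restriction> J) v w = cartan_form G v w"
proof -
  have "(\<Sum>i\<in>J. v $ i * w $ i) = (\<Sum>i\<in>verts G. v $ i * w $ i)"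
    using assms by (intro sum.mono_neutral_left) auto
  moreover have "(\<Sum>(i, j)\<in>arcs_ends G \<inter> J \<times> J. v $ i * w $ j) = (\<Sum>(i, j)\<in>arcs_ends G. v $ i * w $ j)"
    using assms by (intro sum.mono_neutral_left) auto
  ultimately show ?thesis
    by (simp add: cartan_form_eq arcs_ends_induce_subgraph)
qed

lemma roots_induce_subgraph:
  assumes "J \<subseteq> verts G"
  shows "roots (G \<restriction> J) = {\<alpha> \<in> roots G. \<forall>i. i \<notin> J \<longrightarrow> \<alpha> $ i = 0}"
  using assms by (auto simp: roots_def cartan_form_induce_subgraph)

section \<open>Orthogonality to a complex vector through one real functional\<close>

text \<open>A generic combination of \<open>a\<close> and \<open>b\<close> works: each vector in
  \<open>R\<close> that is not orthogonal to \<open>b\<close> rules out a single coefficient, and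
  there are infinitely many reals.\<close>

lemma finite_separating_functional:
  fixes R :: "'a::real_inner set"
  assumes "finite R"
  obtains c where "\<And>\<alpha>. \<alpha> \<in> R \<Longrightarrow> c \<bullet> \<alpha> = 0 \<longleftrightarrow> a \<bullet> \<alpha> = 0 \<and> b \<bullet> \<alpha> = 0"
proof -
  have "infinite (UNIV :: real set)" by (rule infinite_UNIV_char_0)
  \<comment> \<open>If \<open>b \<bullet> \<alpha> = 0\<close>, the quotient is 0 by convention,
    which only removes one more value; such an \<alpha> imposes no condition on
    \<open>t\<close>.\<close>
  with assms obtain t where t: "t \<notin> (\<lambda>\<alpha>. - (a \<bullet> \<alpha>) / (b \<bullet> \<alpha>)) ` R"
    by (meson ex_new_if_finite finite_imageI)
  have "(a + t *\<^sub>R b) \<bullet> \<alpha> = 0 \<longleftrightarrow> a \<bullet> \<alpha> = 0 \<and> b \<bullet> \<alpha> = 0" if "\<alpha> \<in> R" for \<alpha>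
  proof (cases "b \<bullet> \<alpha> = 0")
    case False
    with t that have "t \<noteq> - (a \<bullet> \<alpha>) / (b \<bullet> \<alpha>)" by blast
    with False show ?thesis
      by (auto simp: inner_add_left field_simps)
  qed (simp add: inner_add_left)
  then show ?thesis by (rule that)
qed

lemma mem_perp_iff:
  "x \<in> perp \<tau> \<longleftrightarrow> (\<chi> i. Re (\<tau> $ i)) \<bullet> x = 0 \<and> (\<chi> i. Im (\<tau> $ i)) \<bullet> x = 0"
proof -
  have "x \<in> perp \<tau> \<longleftrightarrow> (\<forall>y\<in>span {\<chi> i. Re (\<tau> $ i), \<chi> i. Im (\<tau> $ i)}. orthogonal x y)"
    by (auto simp: perp_def orthogonal_comp_def orthogonal_commute)
  also have "\<dots> \<longleftrightarrow> (\<forall>y\<in>{\<chi> i. Re (\<tau> $ i), \<chi> i. Im (\<tau> $ i)}. orthogonal x y)"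
  proof (intro iffI ballI)
    fix y
    assume "\<forall>y\<in>span {\<chi> i. Re (\<tau> $ i), \<chi> i. Im (\<tau> $ i)}. orthogonal x y"
      and "y \<in> {\<chi> i. Re (\<tau> $ i), \<chi> i. Im (\<tau> $ i)}"
    then show "orthogonal x y" by (simp only: span_base)
  next
    fix y
    assume "\<forall>y\<in>{\<chi> i. Re (\<tau> $ i), \<chi> i. Im (\<tau> $ i)}. orthogonal x y"
      and "y \<in> span {\<chi> i. Re (\<tau> $ i), \<chi> i. Im (\<tau> $ i)}"
    then show "orthogonal x y" by (simp only: orthogonal_to_span)
  qed
  finally show ?thesis by (simp add: orthogonal_def inner_commute)
qed

section \<open>The Euclidean space of a positive diagram\<close>

text \<open>From here on the type ADE enters only through symmetry, absence of loops and positive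
  definiteness; the vertices are identified with the coordinates.\<close>

locale positive_diagram = wf_digraph K
  for K :: "('n::finite, 'e) pre_digraph" +
  assumes verts_UNIV: "verts K = UNIV"
    and sym_ends: "sym (arcs_ends K)"
    and irrefl_ends: "irrefl (arcs_ends K)"
    and positive: "positive_graph K"
begin

abbreviation form :: "real ^ 'n \<Rightarrow> real ^ 'n \<Rightarrow> real" where
  "form \<equiv> cartan_form K"

lemmas form_bilinear = bilinear_cartan_form[of K]
lemmas form_simps =
  bilinear_ladd[OF form_bilinear] bilinear_radd[OF form_bilinear]
  bilinear_lsub[OF form_bilinear] bilinear_rsub[OF form_bilinear]
  bilinear_lmul[OF form_bilinear] bilinear_rmul[OF form_bilinear]
  bilinear_lneg[OF form_bilinear] bilinear_rneg[OF form_bilinear]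
  bilinear_lzero[OF form_bilinear] bilinear_rzero[OF form_bilinear]

lemma form_commute: "form v w = form w v"
proof -
  have "(\<Sum>(i, j)\<in>arcs_ends K. v $ i * w $ j) = (\<Sum>(i, j)\<in>arcs_ends K. w $ i * v $ j)"
    using sym_ends
    by (intro sum.reindex_bij_witness[of _ prod.swap prod.swap]) (auto dest: symD)
  moreover have "(\<Sum>i\<in>verts K. v $ i * w $ i) = (\<Sum>i\<in>verts K. w $ i * v $ i)"
    by (simp add: mult.commute)
  ultimately show ?thesis by (simp add: cartan_form_eq)
qed

lemma form_pos:
  assumes "v \<noteq> 0"
  shows "form v v > 0"
proof -
  from assms have "\<exists>i\<in>verts K. v $ i \<noteq> 0"
    by (auto simp: vec_eq_iff verts_UNIV)
  with positive[unfolded positive_graph_def, rule_format, of "\<lambda>i. v $ i"]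
  show ?thesis by (simp add: cartan_form_eq power2_eq_square)
qed

lemma form_eq_0_iff: "form v v = 0 \<longleftrightarrow> v = 0"
  using form_pos[of v] by (cases "v = 0") (auto simp: form_simps)

lemma form_right_axis:
  "form v (axis j 1) = 2 * v $ j - (\<Sum>i | (i, j) \<in> arcs_ends K. v $ i)"
proof -
  have "(\<Sum>(a, b)\<in>arcs_ends K. v $ a * axis j 1 $ b) =
      (\<Sum>(a, b)\<in>(\<lambda>i. (i, j)) ` {i. (i, j) \<in> arcs_ends K}. v $ a * axis j 1 $ b)"
    by (intro sum.mono_neutral_right) (auto simp: axis_def)
  also have "\<dots> = (\<Sum>i | (i, j) \<in> arcs_ends K. v $ i)"
    by (simp add: sum.reindex inj_on_def)
  finally show ?thesis
    by (simp add: cartan_form_eq verts_UNIV axis_def if_distrib cong: if_cong)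
qed

lemma form_expand_right: "form v w = (\<Sum>j\<in>UNIV. w $ j * form v (axis j 1))"
proof -
  have "linear (form v)" using form_bilinear by (simp add: bilinear_def)
  have "form v w = form v (\<Sum>j\<in>UNIV. w $ j *\<^sub>R axis j 1)"
    using basis_expansion[of w] by (simp add: scalar_mult_eq_scaleR)
  also have "\<dots> = (\<Sum>j\<in>UNIV. w $ j * form v (axis j 1))"
    by (simp add: linear_sum[OF \<open>linear (form v)\<close>] form_simps)
  finally show ?thesis .
qed

lemma form_disjoint_support:
  assumes "\<And>i. v $ i = 0 \<or> w $ i = 0"
    and "\<And>i j. (i, j) \<in> arcs_ends K \<Longrightarrow> v $ i = 0 \<or> w $ j = 0"
  shows "form v w = 0"
proof -
  have "(\<Sum>i\<in>verts K. v $ i * w $ i) = 0"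
    using assms(1) by (intro sum.neutral) auto
  moreover have "(\<Sum>(i, j)\<in>arcs_ends K. v $ i * w $ j) = 0"
    using assms(2) by (intro sum.neutral) auto
  ultimately show ?thesis by (simp add: cartan_form_eq)
qed

section \<open>Integrality, signs and finiteness of the roots\<close>

definition int_vector :: "real ^ 'n \<Rightarrow> bool" where
  "int_vector v \<longleftrightarrow> (\<forall>i. v $ i \<in> \<int>)"

lemma mem_roots_iff: "\<alpha> \<in> roots K \<longleftrightarrow> int_vector \<alpha> \<and> form \<alpha> \<alpha> = 2"
  by (simp add: roots_def int_vector_def verts_UNIV)

text \<open>The diagonal of the Cartan matrix is 2, and by symmetry each edge contributes the same
  integer twice.\<close>

lemma form_integral_even:
  assumes "int_vector v"
  shows "form v v / 2 \<in> \<int>"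
proof -
  \<comment> \<open>The injection \<open>to_nat\<close> orders the vertices arbitrarily and so
    selects one arc of each edge; without loops no arc is missed.\<close>
  define A where "A = {(i, j) \<in> arcs_ends K. to_nat i < to_nat j}"
  have "arcs_ends K = A \<union> A\<inverse>"
    using sym_ends irrefl_ends
    by (auto simp: A_def irrefl_def dest: symD)
  moreover have "A \<inter> A\<inverse> = {}" by (auto simp: A_def)
  ultimately have "(\<Sum>(i, j)\<in>arcs_ends K. v $ i * v $ j) =
      (\<Sum>(i, j)\<in>A. v $ i * v $ j) + (\<Sum>(i, j)\<in>A\<inverse>. v $ i * v $ j)"
    by (simp add: sum.union_disjoint)
  also have "(\<Sum>(i, j)\<in>A\<inverse>. v $ i * v $ j) = (\<Sum>(i, j)\<in>A. v $ i * v $ j)"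
    by (rule sum.reindex_bij_witness[of _ prod.swap prod.swap]) auto
  finally have "form v v / 2 = (\<Sum>i\<in>verts K. v $ i * v $ i) - (\<Sum>(i, j)\<in>A. v $ i * v $ j)"
    by (simp add: cartan_form_eq)
  also have "\<dots> \<in> \<int>"
    using assms by (auto simp: int_vector_def intro!: Ints_diff Ints_sum Ints_mult)
  finally show ?thesis .
qed

text \<open>An even positive integer is at least 2. The roots are thus the shortest nonzero vectors
  of the lattice.\<close>

lemma form_integral_ge_2:
  assumes "int_vector v" and "v \<noteq> 0"
  shows "form v v \<ge> 2"
proof -
  obtain k :: int where k: "form v v / 2 = of_int k"
    using form_integral_even[OF assms(1)] by (auto elim: Ints_cases)
  with form_pos[OF assms(2)] have "k \<ge> 1" by simp
  with k show ?thesis by simp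
qed

text \<open>Two nonzero lattice vectors each have norm at least 2, so with nonnegative product their
  sum has norm at least 4, too long for a root. This is applied below to the splitting of a root by
  sign and to its splitting along a cut of the graph.\<close>

lemma root_indecomposable:
  assumes "int_vector \<beta>" "int_vector \<gamma>" "form \<beta> \<gamma> \<ge> 0" "\<beta> + \<gamma> \<in> roots K"
  shows "\<beta> = 0 \<or> \<gamma> = 0"
proof (rule ccontr)
  assume "\<not> (\<beta> = 0 \<or> \<gamma> = 0)"
  with assms(1,2) have "form \<beta> \<beta> \<ge> 2" "form \<gamma> \<gamma> \<ge> 2"
    by (auto intro: form_integral_ge_2)
  moreover have "form (\<beta> + \<gamma>) (\<beta> + \<gamma>) = form \<beta> \<beta> + 2 * form \<beta> \<gamma> + form \<gamma> \<gamma>"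
    using form_commute[of \<beta> \<gamma>] by (simp add: form_simps)
  ultimately show False using assms(3,4) by (simp add: mem_roots_iff)
qed

text \<open>The positive and negative parts have disjoint supports, and the off-diagonal entries of
  the Cartan matrix are at most 0. Their product under the form is therefore nonnegative, and
  indecomposability kills one of them.\<close>

lemma root_sign:
  assumes "\<alpha> \<in> roots K"
  shows "(\<forall>i. \<alpha> $ i \<ge> 0) \<or> (\<forall>i. \<alpha> $ i \<le> 0)"
proof -
  define p q :: "real ^ 'n" where "p = (\<chi> i. max (\<alpha> $ i) 0)" and "q = (\<chi> i. min (\<alpha> $ i) 0)"
  have eq: "p + q = \<alpha>" by (auto simp: p_def q_def vec_eq_iff)
  have int: "int_vector p" "int_vector q"
    using assms by (auto simp: p_def q_def mem_roots_iff int_vector_def max_def min_def)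
  have "(\<Sum>i\<in>verts K. p $ i * q $ i) = 0"
    by (intro sum.neutral) (auto simp: p_def q_def max_def min_def)
  moreover have "(\<Sum>(i, j)\<in>arcs_ends K. p $ i * q $ j) \<le> 0"
    by (intro sum_nonpos) (auto simp: p_def q_def mult_nonneg_nonpos)
  ultimately have "form p q \<ge> 0" by (simp add: cartan_form_eq)
  with int eq assms have "p = 0 \<or> q = 0" by (intro root_indecomposable) auto
  then show ?thesis
  proof
    assume "p = 0"
    then have "max (\<alpha> $ i) 0 = 0" for i by (simp add: p_def vec_eq_iff)
    then show ?thesis by (metis max.cobounded1)
  next
    assume "q = 0"
    then have "min (\<alpha> $ i) 0 = 0" for i by (simp add: q_def vec_eq_iff)
    then show ?thesis by (metis min.cobounded1)
  qed
qed

lemma axis_root: "axis i 1 \<in> roots K"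
proof -
  have "(i, i) \<notin> arcs_ends K" using irrefl_ends by (auto simp: irrefl_def)
  then have "(\<Sum>j | (j, i) \<in> arcs_ends K. axis i 1 $ j) = (0 :: real)"
    by (intro sum.neutral) (auto simp: axis_def)
  then have "form (axis i 1) (axis i 1) = 2"
    unfolding form_right_axis by (simp add: axis_def)
  then show ?thesis by (auto simp: mem_roots_iff int_vector_def axis_def)
qed

lemma root_nonzero: "\<alpha> \<in> roots K \<Longrightarrow> \<alpha> \<noteq> 0"
  by (auto simp: mem_roots_iff form_simps)

text \<open>By compactness the form has a positive minimum \<open>m\<close> on the unit sphere. This
  bounds the integer coordinates of every root.\<close>

lemma finite_roots: "finite (roots K)"
proof -
  have "continuous_on (sphere 0 1) (\<lambda>v. form v v)"
    unfolding cartan_form_def by (intro continuous_intros matrix_vector_mult_linear_continuous_on)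
  moreover have "sphere 0 1 \<noteq> ({} :: (real ^ 'n) set)"
    by (metis sphere_eq_empty zero_le_one not_less)
  ultimately obtain u :: "real ^ 'n" where u: "u \<in> sphere 0 1"
    "\<And>v. v \<in> sphere 0 1 \<Longrightarrow> form u u \<le> form v v"
    using continuous_attains_inf[OF compact_sphere] by blast
  define m where "m = form u u"
  have "m > 0" unfolding m_def using u(1) by (intro form_pos) auto
  have bound: "m * (norm v)\<^sup>2 \<le> form v v" for v
  proof (cases "v = 0")
    case False
    then have "m \<le> form (sgn v) (sgn v)"
      unfolding m_def by (intro u(2)) (simp add: norm_sgn)
    also have "\<dots> = form v v / (norm v)\<^sup>2"
      by (simp add: sgn_div_norm form_simps power2_eq_square divide_simps)
    finally show ?thesis using False by (simp add: field_simps)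
  qed (simp add: form_simps)
  have "\<bar>\<alpha> $ i\<bar> \<le> sqrt (2 / m)" if "\<alpha> \<in> roots K" for \<alpha> i
  proof -
    have "(\<alpha> $ i)\<^sup>2 \<le> (norm \<alpha>)\<^sup>2"
      using power_mono[OF component_le_norm_cart[of \<alpha> i], of 2] by simp
    also have "\<dots> \<le> 2 / m"
      using bound[of \<alpha>] that \<open>m > 0\<close> by (simp add: mem_roots_iff field_simps)
    finally show ?thesis by (simp add: real_le_rsqrt)
  qed
  then have "vec_nth ` roots K \<subseteq> (\<Pi>\<^sub>E i\<in>UNIV. {k \<in> \<int>. \<bar>k\<bar> \<le> sqrt (2 / m)})"
    by (auto simp: mem_roots_iff int_vector_def)
  moreover have "finite (\<Pi>\<^sub>E i\<in>(UNIV :: 'n set). {k \<in> \<int>. \<bar>k\<bar> \<le> sqrt (2 / m)})"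
    by (intro finite_PiE) (auto intro: finite_abs_int_segment)
  ultimately have "finite (vec_nth ` roots K)" by (rule finite_subset)
  then show ?thesis
    by (rule finite_imageD) (auto simp: inj_on_def vec_nth_inject)
qed

section \<open>Automorphisms of the root system\<close>

text \<open>This replaces the Weyl group: it contains the simple reflections, is closed under
  composition and is finite, as the maximisation below requires, and membership can be tested
  directly. Only an inclusion is demanded on the roots, since injectivity on a finite set upgrades
  it to equality.\<close>

definition automorphisms :: "(real ^ 'n \<Rightarrow> real ^ 'n) set" where
  "automorphisms = {w. linear w \<and> (\<forall>u v. form (w u) (w v) = form u v) \<and> w ` roots K \<subseteq> roots K}"

lemma automorphism_inj:
  assumes "w \<in> automorphisms"
  shows "inj w"
proof -
  have "linear w" using assms by (simp add: automorphisms_def)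
  moreover have "v = 0" if "w v = 0" for v
    using assms that form_eq_0_iff[of v] by (auto simp: automorphisms_def form_simps dest: spec[of _ v])
  ultimately show ?thesis by (simp add: linear_injective_0)
qed

lemma automorphism_image_roots: "w \<in> automorphisms \<Longrightarrow> w ` roots K = roots K"
  using automorphism_inj[of w] finite_roots
  by (intro endo_inj_surj) (auto simp: automorphisms_def intro: inj_on_subset)

text \<open>A linear map is determined by the images of the simple roots, and for each image there
  are finitely many choices.\<close>

lemma finite_automorphisms: "finite automorphisms"
proof -
  let ?r = "\<lambda>w i. w (axis i 1 :: real ^ 'n)"
  have "inj_on ?r automorphisms"
  proof (rule inj_onI)
    fix w w'
    assume "w \<in> automorphisms" "w' \<in> automorphisms" "?r w = ?r w'"
    then have "linear w" "linear w'" "\<And>b. b \<in> Basis \<Longrightarrow> w b = w' b"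
      by (auto simp: automorphisms_def Basis_vec_def fun_eq_iff)
    then show "w = w'" using linear_eq_stdbasis by blast
  qed
  moreover have "?r ` automorphisms \<subseteq> (\<Pi>\<^sub>E i\<in>UNIV. roots K)"
    using axis_root by (auto simp: automorphisms_def)
  moreover have "finite (\<Pi>\<^sub>E i\<in>(UNIV :: 'n set). roots K)"
    using finite_roots by (intro finite_PiE) auto
  ultimately show ?thesis by (meson finite_imageD finite_subset)
qed

text \<open>This is the reflection in a simple root; its usual coefficient
  \<open>2 * form v e / form e e\<close> simplifies because the root has norm 2. Integer vectors
  stay integral because their product with a simple root is an integer.\<close>

lemma reflection_automorphism: "(\<lambda>v. v - form v (axis i 1) *\<^sub>R axis i 1) \<in> automorphisms"
proof -
  let ?e = "axis i 1 :: real ^ 'n" and ?s = "\<lambda>v. v - form v (axis i 1) *\<^sub>R axis i 1"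
  have e: "form ?e ?e = 2" using axis_root[of i] by (simp add: mem_roots_iff)
  have "linear ?s"
    by (intro linearI) (auto simp: form_simps algebra_simps)
  moreover have iso: "form (?s u) (?s v) = form u v" for u v
    by (simp add: form_simps e form_commute[of ?e v])
  moreover have "int_vector (?s v)" if "int_vector v" for v
  proof -
    have "form v ?e \<in> \<int>"
      using that by (auto simp: form_right_axis int_vector_def intro!: Ints_diff Ints_mult Ints_sum)
    with that show ?thesis
      by (auto simp: int_vector_def axis_def)
  qed
  ultimately show ?thesis
    by (auto simp: automorphisms_def mem_roots_iff)
qed

lemma automorphism_comp:
  "w \<in> automorphisms \<Longrightarrow> w' \<in> automorphisms \<Longrightarrow> w \<circ> w' \<in> automorphisms"
  by (auto simp: automorphisms_def image_subset_iff intro: linear_compose)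

text \<open>Definiteness makes the Cartan matrix injective, hence surjective, and \<rho> is the
  preimage of the vector \<open>1\<close>, all of whose entries are 1.\<close>

lemma weyl_vector_exists: "\<exists>\<rho>. \<forall>i. form \<rho> (axis i 1) = 1"
proof -
  have "linear ((*v) (cartan_matrix K))" by simp
  moreover have "inj ((*v) (cartan_matrix K))"
  proof -
    have "v = 0" if "cartan_matrix K *v v = 0" for v
      using that form_eq_0_iff[of v] by (simp add: cartan_form_def)
    then show ?thesis by (simp add: linear_injective_0)
  qed
  ultimately have "surj ((*v) (cartan_matrix K))"
    by (rule linear_inj_imp_surj)
  then obtain \<rho> where "cartan_matrix K *v \<rho> = 1" by (metis surjD)
  then have "form (axis i 1) \<rho> = 1" for i
    by (simp add: cartan_form_def inner_axis')
  then show ?thesis by (metis form_commute)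
qed

text \<open>Since the reflection in the \<open>i\<close>-th simple root moves \<open>\<rho>\<close> to \<open>\<rho> - axis i 1\<close>, an automorphism
  \<open>w\<close> that maximises \<open>c \<bullet> w \<rho>\<close> makes \<open>c\<close> dominant.\<close>

lemma dominant_automorphism:
  obtains w where "w \<in> automorphisms" and "\<And>i. c \<bullet> w (axis i 1) \<ge> 0"
proof -
  obtain \<rho> where \<rho>: "\<And>i. form \<rho> (axis i 1) = 1" using weyl_vector_exists by blast
  have "finite automorphisms" "automorphisms \<noteq> {}"
    using finite_automorphisms reflection_automorphism by auto
  then obtain w where w: "w \<in> automorphisms" "Max ((\<lambda>w. c \<bullet> w \<rho>) ` automorphisms) = c \<bullet> w \<rho>"
    by (rule obtains_MAX)
  have max: "c \<bullet> w' \<rho> \<le> c \<bullet> w \<rho>" if "w' \<in> automorphisms" for w'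
    unfolding w(2)[symmetric] using that finite_automorphisms by (intro Max_ge) auto
  have "c \<bullet> w (axis i 1) \<ge> 0" for i
  proof -
    have "linear w" using w(1) by (simp add: automorphisms_def)
    then have "c \<bullet> (w \<circ> (\<lambda>v. v - form v (axis i 1) *\<^sub>R axis i 1)) \<rho> = c \<bullet> w \<rho> - c \<bullet> w (axis i 1)"
      by (simp add: \<rho> linear_diff inner_diff_right)
    moreover have "c \<bullet> (w \<circ> (\<lambda>v. v - form v (axis i 1) *\<^sub>R axis i 1)) \<rho> \<le> c \<bullet> w \<rho>"
      by (intro max automorphism_comp w(1) reflection_automorphism)
    ultimately show ?thesis by linarith
  qed
  with w(1) show ?thesis by (rule that)
qed

section \<open>The orthogonal roots as an image of a parabolic subsystem\<close>

lemma roots_perp_parabolic: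
  obtains w J where "w \<in> automorphisms" and "roots K \<inter> perp \<tau> = w ` roots (K \<restriction> J)"
proof -
  obtain c where c: "\<And>\<alpha>. \<alpha> \<in> roots K \<Longrightarrow> c \<bullet> \<alpha> = 0 \<longleftrightarrow> \<alpha> \<in> perp \<tau>"
    using finite_separating_functional[OF finite_roots, of "\<chi> i. Re (\<tau> $ i)" "\<chi> i. Im (\<tau> $ i)"]
    by (metis mem_perp_iff)
  obtain w where w: "w \<in> automorphisms" "\<And>i. c \<bullet> w (axis i 1) \<ge> 0"
    using dominant_automorphism[of c] by blast
  define J where "J = {i. c \<bullet> w (axis i 1) = 0}"
  have "linear w" using w(1) by (simp add: automorphisms_def)
  have expand: "c \<bullet> w \<beta> = (\<Sum>i\<in>UNIV. \<beta> $ i * (c \<bullet> w (axis i 1)))" for \<beta>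
  proof -
    have "w \<beta> = w (\<Sum>i\<in>UNIV. \<beta> $ i *\<^sub>R axis i 1)"
      using basis_expansion[of \<beta>] by (simp add: scalar_mult_eq_scaleR)
    also have "\<dots> = (\<Sum>i\<in>UNIV. \<beta> $ i *\<^sub>R w (axis i 1))"
      using \<open>linear w\<close> by (simp add: linear_sum linear_cmul)
    finally show ?thesis by (simp add: inner_sum_right)
  qed
  \<comment> \<open>Since the coordinates of a root share a sign and the weights
    \<open>c \<bullet> w (axis i 1)\<close> are nonnegative, no cancellation occurs: the sum
    vanishes only if every term does.\<close>
  have iff: "c \<bullet> w \<beta> = 0 \<longleftrightarrow> (\<forall>i. i \<notin> J \<longrightarrow> \<beta> $ i = 0)" if "\<beta> \<in> roots K" for \<beta>
  proof -
    have "c \<bullet> w \<beta> = 0 \<longleftrightarrow> (\<forall>i\<in>UNIV. \<beta> $ i * (c \<bullet> w (axis i 1)) = 0)"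
      using root_sign[OF that]
    proof
      assume "\<forall>i. \<beta> $ i \<ge> 0"
      then show ?thesis
        unfolding expand[of \<beta>] using w(2) by (intro sum_nonneg_eq_0_iff) auto
    next
      assume "\<forall>i. \<beta> $ i \<le> 0"
      then show ?thesis
        unfolding expand[of \<beta>]
        using w(2) sum_nonneg_eq_0_iff[of UNIV "\<lambda>i. - (\<beta> $ i) * (c \<bullet> w (axis i 1))"]
        by (simp add: sum_negf mult_nonpos_nonneg)
    qed
    then show ?thesis by (auto simp: J_def)
  qed
  have "roots (K \<restriction> J) = {\<beta> \<in> roots K. c \<bullet> w \<beta> = 0}"
    using iff by (auto simp: roots_induce_subgraph verts_UNIV)
  \<comment> \<open>As \<open>w\<close> permutes the roots, every root orthogonal to \<tau> is the
    image of a root on which \<open>c\<close> composed with \<open>w\<close> vanishes.\<close>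
  moreover have "roots K \<inter> perp \<tau> = {\<alpha> \<in> w ` roots K. c \<bullet> \<alpha> = 0}"
    using automorphism_image_roots[OF w(1)] c by auto
  ultimately have "roots K \<inter> perp \<tau> = w ` roots (K \<restriction> J)" by auto
  with w(1) show ?thesis by (rule that)
qed

section \<open>Irreducible components and connected components\<close>

text \<open>Take for \<open>L i\<close> the vertices whose simple root lies in
  \<open>\<Psi> i\<close>. Orthogonality confines \<open>\<Psi> i\<close> to vectors supported on
  \<open>L i\<close>, and indecomposability makes \<open>L i\<close> connected.\<close>

lemma component_supports:
  assumes cover: "roots (K \<restriction> J) = (\<Union>i\<in>I. \<Psi> i)"
    and orthogonal: "\<And>i j \<alpha> \<beta>. i \<in> I \<Longrightarrow> j \<in> I \<Longrightarrow> i \<noteq> j \<Longrightarrow> \<alpha> \<in> \<Psi> i \<Longrightarrow> \<beta> \<in> \<Psi> j \<Longrightarrow> form \<alpha> \<beta> = 0"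
    and nonempty: "\<And>i. i \<in> I \<Longrightarrow> \<Psi> i \<noteq> {}"
    and indecomposable: "\<And>i S T. i \<in> I \<Longrightarrow> S \<noteq> {} \<Longrightarrow> T \<noteq> {} \<Longrightarrow> S \<inter> T = {} \<Longrightarrow> \<Psi> i = S \<union> T \<Longrightarrow>
      \<exists>\<alpha>\<in>S. \<exists>\<beta>\<in>T. form \<alpha> \<beta> \<noteq> 0"
  shows "\<exists>L. bij_betw (\<lambda>i. K \<restriction> L i) I (connected_components (K \<restriction> J)) \<and>
    (\<forall>i\<in>I. \<Psi> i = roots (K \<restriction> L i))"
proof -
  define L where "L i = {j. axis j 1 \<in> \<Psi> i}" for i
  have roots_J: "\<Psi> i \<subseteq> roots K" "\<alpha> \<in> \<Psi> i \<Longrightarrow> j \<notin> J \<Longrightarrow> \<alpha> $ j = 0" if "i \<in> I" for i \<alpha> j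
    using that cover by (auto simp: roots_induce_subgraph verts_UNIV)
  have axis_J: "axis j 1 \<in> roots (K \<restriction> J) \<longleftrightarrow> j \<in> J" for j
    using axis_root[of j] by (auto simp: roots_induce_subgraph verts_UNIV axis_def)
  have L_cover: "(\<Union>i\<in>I. L i) = J"
    using cover axis_J by (auto simp: L_def)
  \<comment> \<open>A simple root in two components would be orthogonal to itself, although its norm
    is 2.\<close>
  have L_disjoint: "L i \<inter> L k = {}" if "i \<in> I" "k \<in> I" "i \<noteq> k" for i k
    using orthogonal[OF that] axis_root by (auto simp: L_def mem_roots_iff) fastforce
  \<comment> \<open>Simple roots at adjacent vertices have product -1, whereas those in different
    components are orthogonal.\<close>
  have no_arc: "(j, k) \<notin> arcs_ends K" if i: "i \<in> I" "j \<in> L i" "k \<in> J - L i" for i j k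
  proof
    assume arc: "(j, k) \<in> arcs_ends K"
    obtain i' where i': "i' \<in> I" "k \<in> L i'" using i L_cover by blast
    with i have "i \<noteq> i'" by auto
    have "form (axis j 1) (axis k 1) = 0"
      using i i' \<open>i \<noteq> i'\<close> by (intro orthogonal[of i i']) (auto simp: L_def)
    moreover have "(\<Sum>i | (i, k) \<in> arcs_ends K. axis j 1 $ i) = (1 :: real)"
      using arc by (simp add: axis_def)
    moreover have "j \<noteq> k" using i by auto
    ultimately show False
      unfolding form_right_axis by (simp add: axis_def)
  qed
  \<comment> \<open>Let \<gamma> be the part of \<alpha> outside \<open>L i\<close>. It is
    orthogonal to the part \<beta> inside, as no arc joins the supports, and to \<alpha>, being a
    combination of simple roots in other components. So \<gamma> has norm 0.\<close>
  have supp: "\<alpha> $ j = 0" if "i \<in> I" "\<alpha> \<in> \<Psi> i" "j \<notin> L i" for i \<alpha> j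
  proof -
    define \<beta> \<gamma> :: "real ^ 'n" where "\<beta> = (\<chi> j. if j \<in> L i then \<alpha> $ j else 0)"
      and "\<gamma> = (\<chi> j. if j \<in> L i then 0 else \<alpha> $ j)"
    have eq: "\<alpha> = \<beta> + \<gamma>" by (auto simp: \<beta>_def \<gamma>_def vec_eq_iff)
    have "form \<beta> \<gamma> = 0"
      using no_arc[OF that(1)] roots_J(2)[OF that(1,2)]
      by (intro form_disjoint_support) (auto simp: \<beta>_def \<gamma>_def)
    moreover have "form \<alpha> \<gamma> = 0"
      unfolding form_expand_right[of \<alpha> \<gamma>]
    proof (intro sum.neutral ballI)
      fix k
      show "\<gamma> $ k * form \<alpha> (axis k 1) = 0"
      proof (cases "k \<in> J - L i")
        case True
        with L_cover obtain i' where "i' \<in> I" "k \<in> L i'" "i \<noteq> i'" by blast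
        with that have "form \<alpha> (axis k 1) = 0"
          by (intro orthogonal[of i i']) (auto simp: L_def)
        then show ?thesis by simp
      qed (use roots_J(2)[OF that(1,2)] in \<open>auto simp: \<gamma>_def\<close>)
    qed
    ultimately have "form \<gamma> \<gamma> = 0" by (simp add: eq form_simps)
    then have "\<gamma> $ j = 0" by (simp add: form_eq_0_iff)
    then show ?thesis using that(3) by (simp add: \<gamma>_def)
  qed
  have roots_L: "\<Psi> i = roots (K \<restriction> L i)" if "i \<in> I" for i
  proof (intro equalityI subsetI)
    fix \<alpha>
    assume "\<alpha> \<in> \<Psi> i"
    then show "\<alpha> \<in> roots (K \<restriction> L i)"
      using supp[OF that] roots_J(1)[OF that] by (auto simp: roots_induce_subgraph verts_UNIV)
  next
    fix \<alpha>
    assume "\<alpha> \<in> roots (K \<restriction> L i)"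
    then have \<alpha>: "\<alpha> \<in> roots K" "\<And>j. j \<notin> L i \<Longrightarrow> \<alpha> $ j = 0"
      by (auto simp: roots_induce_subgraph verts_UNIV)
    with L_cover that have "\<alpha> \<in> roots (K \<restriction> J)"
      by (auto simp: roots_induce_subgraph verts_UNIV)
    with cover obtain k where k: "k \<in> I" "\<alpha> \<in> \<Psi> k" by auto
    \<comment> \<open>Otherwise \<alpha> would be supported on the disjoint sets \<open>L k\<close>
      and \<open>L i\<close> at once and would vanish.\<close>
    have "k = i"
    proof (rule ccontr)
      assume "k \<noteq> i"
      with L_disjoint k that have "L k \<inter> L i = {}" by simp
      then have "\<alpha> $ j = 0" for j using \<alpha>(2)[of j] supp[OF k, of j] by blast
      then have "\<alpha> = 0" by (simp add: vec_eq_iff)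
      with \<alpha>(1) root_nonzero show False by blast
    qed
    with k show "\<alpha> \<in> \<Psi> i" by simp
  qed
  have conn: "connected (K \<restriction> L i)" if i: "i \<in> I" for i
  proof (rule connectedI_cut)
    obtain \<alpha> where "\<alpha> \<in> \<Psi> i" using nonempty[OF i] by blast
    then have "\<alpha> \<noteq> 0" using roots_J(1)[OF i] root_nonzero by blast
    then obtain j where "\<alpha> $ j \<noteq> 0" by (auto simp: vec_eq_iff)
    with supp[OF i \<open>\<alpha> \<in> \<Psi> i\<close>] show "verts (K \<restriction> L i) \<noteq> {}" by auto
  next
    fix X
    assume X: "X \<subseteq> verts (K \<restriction> L i)" "X \<noteq> {}" "X \<noteq> verts (K \<restriction> L i)"
    show "\<exists>u\<in>X. \<exists>v\<in>verts (K \<restriction> L i) - X. (u, v) \<in> arcs_ends (K \<restriction> L i)"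
    proof (rule ccontr)
      assume "\<not> ?thesis"
      with X have no: "(u, v) \<notin> arcs_ends K" if "u \<in> X" "v \<in> L i - X" for u v
        using that by (auto simp: arcs_ends_induce_subgraph)
      \<comment> \<open>If no arc leaves \<open>X\<close>, indecomposability puts every root of
        \<open>\<Psi> i\<close> entirely inside \<open>X\<close> or entirely outside it. These two
        classes are orthogonal, contradicting irreducibility; the simple roots at \<open>u\<close>
        and \<open>v\<close> show that neither class is empty.\<close>
      define S T where "S = {\<alpha> \<in> \<Psi> i. \<forall>j. j \<notin> X \<longrightarrow> \<alpha> $ j = 0}"
        and "T = {\<alpha> \<in> \<Psi> i. \<forall>j\<in>X. \<alpha> $ j = 0}"
      obtain u v where uv: "u \<in> X" "v \<in> L i - X" using X by auto
      with X have "axis u 1 \<in> S" "axis v 1 \<in> T"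
        by (auto simp: S_def T_def L_def axis_def)
      then have "S \<noteq> {}" "T \<noteq> {}" by auto
      moreover have "\<alpha> = 0" if "\<alpha> \<in> S" "\<alpha> \<in> T" for \<alpha>
        using that by (auto simp: S_def T_def vec_eq_iff)
      then have "S \<inter> T = {}"
        using roots_J(1)[OF i] root_nonzero by (auto simp: S_def)
      moreover have "\<Psi> i = S \<union> T"
      proof
        show "\<Psi> i \<subseteq> S \<union> T"
        proof
          fix \<alpha>
          assume \<alpha>: "\<alpha> \<in> \<Psi> i"
          define \<beta> \<gamma> :: "real ^ 'n" where "\<beta> = (\<chi> j. if j \<in> X then \<alpha> $ j else 0)"
            and "\<gamma> = (\<chi> j. if j \<in> X then 0 else \<alpha> $ j)"
          have eq: "\<beta> + \<gamma> = \<alpha>" by (auto simp: \<beta>_def \<gamma>_def vec_eq_iff)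
          have root: "\<alpha> \<in> roots K" using \<alpha> roots_J(1)[OF i] by blast
          then have "int_vector \<beta>" "int_vector \<gamma>"
            by (auto simp: \<beta>_def \<gamma>_def mem_roots_iff int_vector_def)
          moreover have "form \<beta> \<gamma> = 0"
            using no supp[OF i \<alpha>] by (intro form_disjoint_support) (auto simp: \<beta>_def \<gamma>_def)
          ultimately have "\<beta> = 0 \<or> \<gamma> = 0"
            using root eq by (intro root_indecomposable) auto
          with \<alpha> show "\<alpha> \<in> S \<union> T"
            by (auto simp: S_def T_def \<beta>_def \<gamma>_def vec_eq_iff split: if_splits)
        qed
      qed (auto simp: S_def T_def)
      ultimately obtain \<alpha> \<beta> where \<alpha>\<beta>: "\<alpha> \<in> S" "\<beta> \<in> T" "form \<alpha> \<beta> \<noteq> 0"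
        using indecomposable[OF i, of S T] by blast
      have "form \<alpha> \<beta> = 0"
      proof (rule form_disjoint_support)
        show "\<alpha> $ j = 0 \<or> \<beta> $ j = 0" for j
          using \<alpha>\<beta>(1,2) by (auto simp: S_def T_def)
      next
        fix j k
        assume "(j, k) \<in> arcs_ends K"
        then have "j \<notin> X \<or> k \<notin> L i - X" using no by blast
        then show "\<alpha> $ j = 0 \<or> \<beta> $ k = 0"
          using \<alpha>\<beta>(1,2) supp[OF i, of \<beta> k] by (auto simp: S_def T_def)
      qed
      with \<alpha>\<beta>(3) show False by simp
    qed
  qed
  interpret KJ: wf_digraph "K \<restriction> J" by (rule wellformed_induce_subgraph)
  have L_sub: "L i \<subseteq> J" if "i \<in> I" for i using that L_cover by blast
  have "bij_betw (\<lambda>i. (K \<restriction> J) \<restriction> L i) I (connected_components (K \<restriction> J))"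
  proof (rule KJ.connected_components_partition)
    show "connected ((K \<restriction> J) \<restriction> L i)" if "i \<in> I" for i
      using conn[OF that] L_sub[OF that] by (simp add: induce_subgraph_induce_subgraph)
    show "x \<in> L i \<longleftrightarrow> y \<in> L i" if "i \<in> I" "(x, y) \<in> arcs_ends (K \<restriction> J)" for i x y
      using that no_arc[OF that(1)] sym_ends
      by (auto simp: arcs_ends_induce_subgraph dest: symD)
  qed (use L_cover L_disjoint in auto)
  then have "bij_betw (\<lambda>i. K \<restriction> L i) I (connected_components (K \<restriction> J))"
    using L_sub by (simp add: induce_subgraph_induce_subgraph cong: bij_betw_cong)
  with roots_L show ?thesis by blast
qed

text \<open>The isomorphism is a linear left inverse of \<open>w\<close>. It preserves Cartan
  integers because \<open>w\<close> is an isometry and the forms of \<open>K\<close> and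
  \<open>K \<restriction> L\<close> agree on vectors supported on \<open>L\<close>.\<close>

lemma automorphism_root_system_isomorphic:
  assumes w: "w \<in> automorphisms"
  shows "root_system_isomorphic form (w ` roots (K \<restriction> L)) (cartan_form (K \<restriction> L)) (roots (K \<restriction> L))"
proof -
  have "linear w" using w by (simp add: automorphisms_def)
  then obtain g where g: "linear g" "g \<circ> w = id"
    using linear_injective_left_inverse automorphism_inj[OF w] by blast
  then have gw [simp]: "g (w x) = x" for x by (simp add: fun_eq_iff)
  let ?R = "roots (K \<restriction> L)"
  have "span (w ` ?R) = w ` span ?R"
    by (rule linear_span_image[OF \<open>linear w\<close>])
  then have "bij_betw g (span (w ` ?R)) (span ?R)"
    by (intro bij_betw_byWitness[of _ w]) auto
  moreover have "g ` w ` ?R = ?R" by (simp add: image_image)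
  moreover have "cartan_integer (cartan_form (K \<restriction> L)) (g \<beta>) (g \<alpha>) = cartan_integer form \<beta> \<alpha>"
    if \<alpha>: "\<alpha> \<in> w ` ?R" and \<beta>: "\<beta> \<in> w ` ?R" for \<alpha> \<beta>
  proof -
    from \<alpha> obtain a where a: "\<alpha> = w a" "a \<in> ?R" by blast
    from \<beta> obtain b where b: "\<beta> = w b" "b \<in> ?R" by blast
    have "cartan_form (K \<restriction> L) x y = form x y" if "x \<in> ?R" "y \<in> ?R" for x y
      using that by (intro cartan_form_induce_subgraph) (auto simp: verts_UNIV roots_induce_subgraph)
    with a(2) b(2) w show ?thesis
      unfolding a(1) b(1) by (simp add: cartan_integer_def automorphisms_def)
  qed
  ultimately show ?thesis
    unfolding root_system_isomorphic_def using g(1) by blast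
qed

end

section \<open>Transport of the irreducible components along the automorphism\<close>

theorem proposition8p3:
  fixes K :: "('n::finite, 'e) pre_digraph"
    and \<tau> :: "complex ^ 'n"
    and r :: nat
    and \<Phi> :: "nat \<Rightarrow> (real ^ 'n) set"
  assumes "ADE_diagram K" and "verts K = UNIV"
    and "irreducible_decomposition (cartan_form K) (roots K \<inter> perp \<tau>) {1..r} \<Phi>"
  shows "\<exists>K' Ks. induced_subgraph K' K \<and> bij_betw Ks {1..r} (connected_components K') \<and>
    (\<forall>i\<in>{1..r}. root_system_isomorphic
       (cartan_form K) (\<Phi> i) (cartan_form (Ks i)) (roots (Ks i)))"
proof -
  interpret wf_digraph K using assms(1) by (rule ADE_diagram_properties)
  interpret positive_diagram K
    using ADE_diagram_properties[OF assms(1)] assms(2) by unfold_locales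
  obtain w J where w: "w \<in> automorphisms" and J: "roots K \<inter> perp \<tau> = w ` roots (K \<restriction> J)"
    by (rule roots_perp_parabolic)
  have form_w: "form (w u) (w v) = form u v" for u v
    using w by (simp add: automorphisms_def)
  have inj_w: "inj w" using w by (rule automorphism_inj)
  have cover: "w ` roots (K \<restriction> J) = (\<Union>i\<in>{1..r}. \<Phi> i)"
    and orth: "\<And>i j \<alpha> \<beta>. i \<in> {1..r} \<Longrightarrow> j \<in> {1..r} \<Longrightarrow> i \<noteq> j \<Longrightarrow>
      \<alpha> \<in> \<Phi> i \<Longrightarrow> \<beta> \<in> \<Phi> j \<Longrightarrow> form \<alpha> \<beta> = 0"
    and irreducible: "\<And>i. i \<in> {1..r} \<Longrightarrow> irreducible_root_system form (\<Phi> i)"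
    using assms(3) unfolding irreducible_decomposition_def J by blast+
  \<comment> \<open>Pulling the components back along \<open>w\<close> places them in
    \<open>roots (K \<restriction> J)\<close>, where the simple roots of \<open>J\<close> can be
    sorted among them.\<close>
  define \<Psi> where "\<Psi> i = w -` \<Phi> i" for i
  have w_\<Psi>: "w ` \<Psi> i = \<Phi> i" if "i \<in> {1..r}" for i
    using that cover unfolding \<Psi>_def
    by (metis UN_upper image_vimage_eq Int_absorb2 image_mono subset_UNIV subset_trans)
  have "roots (K \<restriction> J) = w -` w ` roots (K \<restriction> J)"
    using inj_w by (simp add: inj_vimage_image_eq)
  then have "roots (K \<restriction> J) = (\<Union>i\<in>{1..r}. \<Psi> i)"
    unfolding cover by (simp add: \<Psi>_def vimage_UN)
  then have "\<exists>L. bij_betw (\<lambda>i. K \<restriction> L i) {1..r} (connected_components (K \<restriction> J)) \<and>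
      (\<forall>i\<in>{1..r}. \<Psi> i = roots (K \<restriction> L i))"
  proof (rule component_supports)
    fix i j \<alpha> \<beta>
    assume "i \<in> {1..r}" "j \<in> {1..r}" "i \<noteq> j" "\<alpha> \<in> \<Psi> i" "\<beta> \<in> \<Psi> j"
    then show "form \<alpha> \<beta> = 0"
      using orth[of i j "w \<alpha>" "w \<beta>"] by (simp add: \<Psi>_def form_w)
  next
    fix i
    assume "i \<in> {1..r}"
    then show "\<Psi> i \<noteq> {}"
      using irreducible[of i] w_\<Psi>[of i] by (auto simp: irreducible_root_system_def)
  next
    fix i S T
    assume i: "i \<in> {1..r}" and ST: "S \<noteq> {}" "T \<noteq> {}" "S \<inter> T = {}" "\<Psi> i = S \<union> T"
    \<comment> \<open>An orthogonal splitting of \<open>\<Psi> i\<close> would be carried by the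
      injective isometry \<open>w\<close> to one of the irreducible system
      \<open>\<Phi> i\<close>.\<close>
    have "w ` S \<inter> w ` T = {}"
      using ST(3) inj_w by (metis image_Int image_empty)
    moreover have "\<Phi> i = w ` S \<union> w ` T"
      using w_\<Psi>[OF i] ST(4) by (simp add: image_Un)
    moreover have "w ` S \<noteq> {}" "w ` T \<noteq> {}" using ST(1,2) by simp_all
    moreover have "\<nexists>S T. S \<noteq> {} \<and> T \<noteq> {} \<and> S \<inter> T = {} \<and> \<Phi> i = S \<union> T \<and>
        (\<forall>\<alpha>\<in>S. \<forall>\<beta>\<in>T. form \<alpha> \<beta> = 0)"
      using irreducible[OF i] unfolding irreducible_root_system_def by (elim conjE)
    ultimately have "\<not> (\<forall>\<alpha>\<in>w ` S. \<forall>\<beta>\<in>w ` T. form \<alpha> \<beta> = 0)"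
      by metis
    then show "\<exists>\<alpha>\<in>S. \<exists>\<beta>\<in>T. form \<alpha> \<beta> \<noteq> 0"
      by (simp add: form_w)
  qed
  then obtain L where L: "bij_betw (\<lambda>i. K \<restriction> L i) {1..r} (connected_components (K \<restriction> J))"
    "\<And>i. i \<in> {1..r} \<Longrightarrow> \<Psi> i = roots (K \<restriction> L i)"
    by blast
  have "root_system_isomorphic form (\<Phi> i) (cartan_form (K \<restriction> L i)) (roots (K \<restriction> L i))"
    if "i \<in> {1..r}" for i
    using automorphism_root_system_isomorphic[OF w, of "L i"] w_\<Psi>[OF that] L(2)[OF that] by simp
  moreover have "induced_subgraph (K \<restriction> J) K"
    using assms(2) by (intro induced_induce) simp
  ultimately show ?thesis using L(1) by blast
qed

end
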